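(* Let $f,\bar f:\mathbb V^{n_x}\to\mathbb V^{n_x}$ be the full-system and truth full-system uncertainty-propagation operators of a network with component operators $f_i,\bar f_i$, $i=1,\dots,n$. Assume: (i) For each $i$ there are linear subspaces $\mathbb X_i\subseteq\bar{\mathbb X}_i\subseteq\mathbb V^{n_{x,i}}$ with $\mathrm{Im}(f_i)\subseteq\mathbb X_i$ and $\mathrm{Im}(\bar f_i)\subseteq\bar{\mathbb X}_i$. Let $P_i$ be the orthogonal projector onto $\mathbb X_i$ and $P$ the orthogonal projector onto $\mathbb X=\mathbb X_1\times\cdots\times\mathbb X_n$. (ii) For each $i$ there is an operator $\bar f_i^\perp:\mathbb V^{n_{y,i}}\to\mathbb V^{n_{x,i}}$ with $\mathrm{Im}(\bar f_i^\perp)\subseteq\mathbb X_i^\perp$ such that $$\bar f_i(E_i^yAx)=f_i(E_i^yAPx)+\bar f_i^\perp(E_i^yAx)\qquad\text{for all }x\in\mathbb V^{n_x}.$$ (iii) The fixed-point system $x=f(x)$ has a unique solution $x_\star$. Let $\bar x_\star$ be a solution of the truth fixed-point system $\bar x_\star=\bar f(\bar x_\star)$. Then $$x_\star=P\bar x_\star,$$ i.e. the in-plane error $P\bar x_\star-x_\star$ is zero.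
   Context: $\mathbb V$ is the real vector space of real-valued random variables on a fixed probability space, with norm induced by an inner product (e.g. $\|x\|=\sqrt{\mathbb E[x^2]}$); it may be treated as an abstract real inner product space. $\mathbb V^N$ carries the product inner product (sum of the componentwise inner products) and its norm. Network: there are $n$ components; component $i$ has $n_{y,i}$ endogenous inputs and $n_{x,i}$ outputs, $n_y=\sum_i n_{y,i}$, $n_x=\sum_i n_{x,i}$. Exogenous inputs are fixed throughout and suppressed from the notation. Each component has an uncertainty-propagation operator $f_i:\mathbb V^{n_{y,i}}\to\mathbb V^{n_{x,i}}$ and a "truth" operator $\bar f_i:\mathbb V^{n_{y,i}}\to\mathbb V^{n_{x,i}}$. $E_i^x\in\{0,1\}^{n_{x,i}\times n_x}$ and $E_i^y\in\{0,1\}^{n_{y,i}\times n_y}$ are the rows of the identity matrix extracting the block of component $i$. The adjacency matrix $A\in\{0,1\}^{n_y\times n_x}$ expresses the endogenous inputs as outputs, $y=Ax$; its diagonal blocks $E_i^yA(E_i^x)^T$ are zero. The full-system operators are $$f(x)=\sum_{i=1}^n(E_i^x)^Tf_i(E_i^yAx),\qquad \bar f(x)=\sum_{i=1}^n(E_i^x)^T\bar f_i(E_i^yAx).$$ The orthogonal projectors $P_i$ are assumed to exist: $P_i$ is the linear operator with $P_iz=\arg\min_{\tilde z\in\mathbb X_i}\|z-\tilde z\|$, and $P=\sum_{i=1}^n(E_i^x)^TP_iE_i^x$. $\mathbb X_i^\perp$ is the orthogonal complement of $\mathbb X_i$ in $\mathbb V^{n_{x,i}}$. *)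

theory Defs
  imports "HOL-Analysis.Inner_Product" "Jordan_Normal_Form.Matrix"
begin

text \<open>
  For a real inner product space \<open>'v\<close> (the space of random variables), the space \<open>\<V>\<^sup>N\<close> is
  \<^term>\<open>carrier_vec N :: 'v vec set\<close>. The dimensions of the component spaces depend on the
  component index, which is why they are carriers of one type and not types themselves.
  The library provides addition, subtraction and zero on \<^typ>\<open>'v vec\<close>; its scalar
  multiplication and matrix-vector product require the entries to lie in the scalar ring, so the
  real versions are defined here.
\<close>

definition vscale :: "real \<Rightarrow> 'v::real_vector vec \<Rightarrow> 'v vec" where
  "vscale c x = map_vec (scaleR c) x"

definition vinner :: "'v::real_inner vec \<Rightarrow> 'v vec \<Rightarrow> real" where
  "vinner x y = (\<Sum>k<dim_vec x. inner (x $ k) (y $ k))"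

definition vnorm :: "'v::real_inner vec \<Rightarrow> real" where
  "vnorm x = sqrt (vinner x x)"

definition act :: "real mat \<Rightarrow> 'v::real_vector vec \<Rightarrow> 'v vec" (infixr \<open>\<star>\<close> 72) where
  "M \<star> x = vec (dim_row M) (\<lambda>r. \<Sum>c<dim_col M. (M $$ (r, c)) *\<^sub>R (x $ c))"

definition vsubspace :: "nat \<Rightarrow> 'v::real_vector vec set \<Rightarrow> bool" where
  "vsubspace N S \<longleftrightarrow> S \<subseteq> carrier_vec N \<and> 0\<^sub>v N \<in> S \<and>
     (\<forall>x\<in>S. \<forall>y\<in>S. x + y \<in> S) \<and> (\<forall>c. \<forall>x\<in>S. vscale c x \<in> S)"

definition vperp :: "nat \<Rightarrow> 'v::real_inner vec set \<Rightarrow> 'v vec set" where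
  "vperp N S = {z \<in> carrier_vec N. \<forall>s\<in>S. vinner s z = 0}"

definition vlinear :: "nat \<Rightarrow> nat \<Rightarrow> ('v::real_vector vec \<Rightarrow> 'v vec) \<Rightarrow> bool" where
  "vlinear N M T \<longleftrightarrow> T \<in> carrier_vec N \<rightarrow> carrier_vec M \<and>
     (\<forall>x\<in>carrier_vec N. \<forall>y\<in>carrier_vec N. T (x + y) = T x + T y) \<and>
     (\<forall>c. \<forall>x\<in>carrier_vec N. T (vscale c x) = vscale c (T x))"

definition orth_projector ::
    "nat \<Rightarrow> 'v::real_inner vec set \<Rightarrow> ('v vec \<Rightarrow> 'v vec) \<Rightarrow> bool" where
  "orth_projector N S T \<longleftrightarrow> vlinear N N T \<and>
     (\<forall>z\<in>carrier_vec N. is_arg_min (\<lambda>w. vnorm (z - w)) (\<lambda>w. w \<in> S) (T z))"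

text \<open>
  Components are numbered \<open>0, \<dots>, n - 1\<close> and component \<open>i\<close> has block size \<open>d i\<close>. The matrix
  \<open>block_sel d n i\<close> consists of the rows of the identity matrix that extract block \<open>i\<close>; it is
  \<open>E\<^sub>i\<^sup>x\<close> for \<open>d = nx\<close> and \<open>E\<^sub>i\<^sup>y\<close> for \<open>d = ny\<close>.
\<close>

definition block_sel :: "(nat \<Rightarrow> nat) \<Rightarrow> nat \<Rightarrow> nat \<Rightarrow> real mat" where
  "block_sel d n i =
     mat (d i) (sum d {..<n}) (\<lambda>(r, c). 1\<^sub>m (sum d {..<n}) $$ (sum d {..<i} + r, c))"

definition full_op ::
    "nat \<Rightarrow> (nat \<Rightarrow> nat) \<Rightarrow> (nat \<Rightarrow> nat) \<Rightarrow> real mat \<Rightarrow> (nat \<Rightarrow> 'v::real_vector vec \<Rightarrow> 'v vec)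
      \<Rightarrow> 'v vec \<Rightarrow> 'v vec" where
  "full_op n nx ny A f x =
     finsum_vec TYPE('v) (sum nx {..<n})
       (\<lambda>i. transpose_mat (block_sel nx n i) \<star> f i (block_sel ny n i \<star> A \<star> x)) {..<n}"

definition full_proj ::
    "nat \<Rightarrow> (nat \<Rightarrow> nat) \<Rightarrow> (nat \<Rightarrow> 'v::real_vector vec \<Rightarrow> 'v vec) \<Rightarrow> 'v vec \<Rightarrow> 'v vec" where
  "full_proj n nx P x =
     finsum_vec TYPE('v) (sum nx {..<n})
       (\<lambda>i. transpose_mat (block_sel nx n i) \<star> P i (block_sel nx n i \<star> x)) {..<n}"

definition prod_space ::
    "nat \<Rightarrow> (nat \<Rightarrow> nat) \<Rightarrow> (nat \<Rightarrow> 'v::real_vector vec set) \<Rightarrow> 'v vec set" where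
  "prod_space n nx X =
     {x \<in> carrier_vec (sum nx {..<n}). \<forall>i<n. block_sel nx n i \<star> x \<in> X i}"

lemma block_offset_bound:
  fixes d :: "nat \<Rightarrow> nat"
  assumes "i < n" "r < d i"
  shows "sum d {..<i} + r < sum d {..<n}"
proof -
  have "sum d {..<i} + r < sum d {..<Suc i}" using assms by simp
  also have "\<dots> \<le> sum d {..<n}" using assms by (intro sum_mono2) auto
  finally show ?thesis .
qed

lemma block_offset_disjoint:
  fixes d :: "nat \<Rightarrow> nat"
  assumes "r < d i" "s < d j" "sum d {..<i} + r = sum d {..<j} + s"
  shows "i = j \<and> r = s"
proof -
  have "i = j"
    using block_offset_bound[of i j r d] block_offset_bound[of j i s d] assms
    by (metis add_lessD1 less_not_refl linorder_neqE_nat not_add_less1)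
  thus ?thesis using assms by simp
qed

lemma block_offset_ex:
  fixes d :: "nat \<Rightarrow> nat"
  assumes "k < sum d {..<n}"
  shows "\<exists>i<n. \<exists>r<d i. k = sum d {..<i} + r"
  using assms
proof (induction n)
  case (Suc n)
  show ?case
  proof (cases "k < sum d {..<n}")
    case True
    with Suc show ?thesis using less_Suc_eq by auto
  next
    case False
    with Suc.prems have "k - sum d {..<n} < d n" "k = sum d {..<n} + (k - sum d {..<n})" by auto
    thus ?thesis by blast
  qed
qed simp

lemma sum_blocks:
  fixes g :: "nat \<Rightarrow> real" and d :: "nat \<Rightarrow> nat"
  shows "(\<Sum>k<sum d {..<n}. g k) = (\<Sum>i<n. \<Sum>r<d i. g (sum d {..<i} + r))"
proof (induction n)
  case (Suc n)
  have "(\<Sum>k<M + m. g k) = (\<Sum>k<M. g k) + (\<Sum>r<m. g (M + r))" for M m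
    by (induction m) (auto simp: add.assoc)
  with Suc show ?case by simp
qed simp

lemma block_sel_act:
  assumes "i < n"
  shows "dim_vec (block_sel d n i \<star> x) = d i"
    and "r < d i \<Longrightarrow> (block_sel d n i \<star> x) $ r = x $ (sum d {..<i} + r)"
proof -
  show "dim_vec (block_sel d n i \<star> x) = d i" by (simp add: act_def block_sel_def)
  assume r: "r < d i"
  note b = block_offset_bound[of i n r d, OF assms r]
  show "(block_sel d n i \<star> x) $ r = x $ (sum d {..<i} + r)"
    using r b by (simp add: act_def block_sel_def if_distrib[of "\<lambda>a. a *\<^sub>R _"] cong: if_cong)
qed

lemma block_sel_transpose_act:
  assumes "i < n" "j < n" "r < d i"
  shows "(transpose_mat (block_sel d n j) \<star> u) $ (sum d {..<i} + r) = (if j = i then u $ r else 0)"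
proof -
  note b = block_offset_bound[of i n r d, OF assms(1,3)]
  have e: "sum d {..<j} + c = sum d {..<i} + r \<longleftrightarrow> j = i \<and> c = r" if "c < d j" for c
    using block_offset_disjoint[of c d j r i] that assms(3) by auto
  have "(transpose_mat (block_sel d n j) \<star> u) $ (sum d {..<i} + r) =
      (\<Sum>c<d j. if j = i \<and> c = r then u $ c else 0)"
    using b assms block_offset_bound[of j n _ d]
    by (simp add: act_def block_sel_def) (auto simp: e intro!: sum.cong)
  also have "\<dots> = (if j = i then u $ r else 0)" using assms by auto
  finally show ?thesis .
qed

lemma full_proj_carrier: "full_proj n nx P x \<in> carrier_vec (sum nx {..<n})"
  unfolding full_proj_def
  by (rule finsum_vec_closed) (auto simp: act_def block_sel_def)

lemma full_proj_index:
  assumes "i < n" "r < nx i"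
  shows "full_proj n nx P x $ (sum nx {..<i} + r) = P i (block_sel nx n i \<star> x) $ r"
proof -
  have "full_proj n nx P x $ (sum nx {..<i} + r) =
     (\<Sum>j<n. (transpose_mat (block_sel nx n j) \<star> P j (block_sel nx n j \<star> x)) $ (sum nx {..<i} + r))"
    unfolding full_proj_def
    by (rule index_finsum_vec)
      (use assms block_offset_bound[of i n r nx] in \<open>auto simp: act_def block_sel_def\<close>)
  also have "\<dots> = (\<Sum>j<n. if j = i then P j (block_sel nx n j \<star> x) $ r else 0)"
    using assms by (intro sum.cong) (auto simp: block_sel_transpose_act)
  finally show ?thesis using assms by simp
qed

lemma block_full_proj:
  assumes "i < n" "P i (block_sel nx n i \<star> x) \<in> carrier_vec (nx i)"
  shows "block_sel nx n i \<star> full_proj n nx P x = P i (block_sel nx n i \<star> x)"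
  using assms by (intro eq_vecI) (auto simp: block_sel_act full_proj_index)

lemma vec_block_eqI:
  fixes d :: "nat \<Rightarrow> nat"
  assumes "x \<in> carrier_vec (sum d {..<n})" "y \<in> carrier_vec (sum d {..<n})"
    and "\<And>i r. i < n \<Longrightarrow> r < d i \<Longrightarrow> x $ (sum d {..<i} + r) = y $ (sum d {..<i} + r)"
  shows "x = y"
proof (rule eq_vecI)
  fix k assume "k < dim_vec y"
  with assms(2) have "k < sum d {..<n}" by simp
  then obtain i r where "i < n" "r < d i" "k = sum d {..<i} + r" using block_offset_ex[of k d n] by blast
  with assms(3) show "x $ k = y $ k" by simp
qed (use assms in simp)

lemma vnorm_blocks:
  assumes "x \<in> carrier_vec (sum d {..<n})"
  shows "vnorm x = sqrt (\<Sum>i<n. vinner (block_sel d n i \<star> x) (block_sel d n i \<star> x))"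
  using assms by (auto simp: vnorm_def vinner_def sum_blocks block_sel_act intro!: sum.cong)

lemma block_sel_add:
  assumes "i < n" "x \<in> carrier_vec (sum d {..<n})" "y \<in> carrier_vec (sum d {..<n})"
  shows "block_sel d n i \<star> (x + y) = (block_sel d n i \<star> x) + (block_sel d n i \<star> y)"
  using assms by (intro eq_vecI) (auto simp: block_sel_act block_offset_bound)

lemma block_sel_diff:
  fixes x y :: "'v::real_vector vec"
  assumes "i < n" "x \<in> carrier_vec (sum d {..<n})" "y \<in> carrier_vec (sum d {..<n})"
  shows "block_sel d n i \<star> (x - y) = (block_sel d n i \<star> x) - (block_sel d n i \<star> y)"
  using assms by (intro eq_vecI) (auto simp: block_sel_act block_offset_bound)

lemma block_sel_scale:
  assumes "i < n" "x \<in> carrier_vec (sum d {..<n})"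
  shows "block_sel d n i \<star> vscale c x = vscale c (block_sel d n i \<star> x)"
  using assms by (intro eq_vecI) (auto simp: block_sel_act block_offset_bound vscale_def)

text \<open>The block formula defining \<^const>\<open>full_proj\<close> does give the orthogonal projector onto the
  product of the component subspaces.\<close>

theorem full_proj_orth_projector:
  fixes P :: "nat \<Rightarrow> 'v::real_inner vec \<Rightarrow> 'v vec"
  assumes P: "\<And>i. i < n \<Longrightarrow> orth_projector (nx i) (X i) (P i)"
  shows "orth_projector (sum nx {..<n}) (prod_space n nx X) (full_proj n nx P)"
proof -
  let ?N = "sum nx {..<n}" and ?E = "block_sel nx n" and ?P = "full_proj n nx P"
  have E: "?E i \<star> x \<in> carrier_vec (nx i)" if "i < n" for i and x :: "'v vec"
    by (rule carrier_vecI) (rule block_sel_act(1)[OF that])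
  have lin: "vlinear (nx i) (nx i) (P i)"
    and min: "\<And>z. z \<in> carrier_vec (nx i) \<Longrightarrow> P i z \<in> X i"
      "\<And>z w. z \<in> carrier_vec (nx i) \<Longrightarrow> w \<in> X i \<Longrightarrow> vnorm (z - P i z) \<le> vnorm (z - w)"
    if "i < n" for i
    using P[OF that] by (auto simp: orth_projector_def is_arg_min_linorder)
  have PE: "P i (?E i \<star> x) \<in> carrier_vec (nx i)" if "i < n" for i x
    using lin[OF that] E[OF that, of x] by (auto simp: vlinear_def)
  have C: "?P x \<in> carrier_vec ?N" for x by (rule full_proj_carrier)
  have add: "?P (x + y) = ?P x + ?P y" if "x \<in> carrier_vec ?N" "y \<in> carrier_vec ?N" for x y
  proof (rule vec_block_eqI[of _ nx n])
    fix i r assume ir: "i < n" "r < nx i"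
    have "P i (?E i \<star> (x + y)) = P i (?E i \<star> x) + P i (?E i \<star> y)"
      unfolding block_sel_add[OF ir(1) that]
      using lin[OF ir(1)] E[OF ir(1)] unfolding vlinear_def by blast
    thus "?P (x + y) $ (sum nx {..<i} + r) = (?P x + ?P y) $ (sum nx {..<i} + r)"
      using ir block_offset_bound[of i n r nx, OF ir] carrier_vecD[OF C] carrier_vecD[OF PE[OF ir(1)]]
      by (simp add: full_proj_index)
  qed (use C in auto)
  have scale: "?P (vscale c x) = vscale c (?P x)" if "x \<in> carrier_vec ?N" for c x
  proof (rule vec_block_eqI[of _ nx n])
    fix i r assume ir: "i < n" "r < nx i"
    have "P i (?E i \<star> vscale c x) = vscale c (P i (?E i \<star> x))"
      unfolding block_sel_scale[OF ir(1) that]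
      using lin[OF ir(1)] E[OF ir(1)] unfolding vlinear_def by blast
    thus "?P (vscale c x) $ (sum nx {..<i} + r) = vscale c (?P x) $ (sum nx {..<i} + r)"
      using ir block_offset_bound[of i n r nx, OF ir] carrier_vecD[OF C] carrier_vecD[OF PE[OF ir(1)]]
      by (simp add: full_proj_index vscale_def)
  qed (use C in \<open>auto simp: vscale_def\<close>)
  have mem: "?P z \<in> prod_space n nx X" for z
    using C PE E min(1) by (simp add: prod_space_def block_full_proj)
  have le: "vnorm (z - ?P z) \<le> vnorm (z - w)"
    if z: "z \<in> carrier_vec ?N" and w: "w \<in> prod_space n nx X" for z w
  proof -
    have w': "w \<in> carrier_vec ?N" "\<And>i. i < n \<Longrightarrow> ?E i \<star> w \<in> X i"
      using w by (auto simp: prod_space_def)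
    have "vinner (?E i \<star> (z - ?P z)) (?E i \<star> (z - ?P z)) \<le> vinner (?E i \<star> (z - w)) (?E i \<star> (z - w))"
      if i: "i < n" for i
    proof -
      have "vnorm (?E i \<star> (z - ?P z)) \<le> vnorm (?E i \<star> (z - w))"
        unfolding block_sel_diff[OF i z C] block_sel_diff[OF i z w'(1)]
          block_full_proj[of i n P, OF i PE[OF i]]
        by (rule min(2)[OF i E[OF i] w'(2)[OF i]])
      thus ?thesis by (simp add: vnorm_def)
    qed
    hence "(\<Sum>i<n. vinner (?E i \<star> (z - ?P z)) (?E i \<star> (z - ?P z)))
        \<le> (\<Sum>i<n. vinner (?E i \<star> (z - w)) (?E i \<star> (z - w)))"
      by (intro sum_mono) simp
    moreover have "z - ?P z \<in> carrier_vec ?N" "z - w \<in> carrier_vec ?N"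
      using z w' C by auto
    ultimately show ?thesis by (simp add: vnorm_blocks)
  qed
  have "vlinear ?N ?N ?P"
    unfolding vlinear_def using C add scale by blast
  moreover have "is_arg_min (\<lambda>w. vnorm (z - w)) (\<lambda>w. w \<in> prod_space n nx X) (?P z)"
    if "z \<in> carrier_vec ?N" for z
    unfolding is_arg_min_linorder using mem le[OF that] by blast
  ultimately show ?thesis unfolding orth_projector_def by blast
qed

end

theory Submission
  imports Defs
begin

text \<open>
  The hypothesis on the truth operators splits the output of component \<open>i\<close> into \<open>f\<^sub>i\<close> evaluated at the \<^emph>\<open>projected\<close>
  state, which lies in \<open>X\<^sub>i\<close>, plus a remainder in the orthogonal complement of \<open>X\<^sub>i\<close>. An orthogonal
  projector discards exactly such a remainder (\<open>orth_projector_decomposition\<close>). Applying the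
  projector of each component to the block equations (\<open>block_full_op\<close>) of
  \<open>xbar = fbar(xbar)\<close> therefore leaves \<open>P xbar = f(P xbar)\<close>: the projected truth
  solution solves the unprojected fixed-point system, whose solution is unique.
\<close>

lemma vinner_self_eq_0:
  assumes "x \<in> carrier_vec N" "vinner x x \<le> 0"
  shows "x = 0\<^sub>v N"
proof -
  have "(\<Sum>k<N. inner (x $ k) (x $ k)) = 0"
    using assms by (intro antisym sum_nonneg) (auto simp: vinner_def)
  hence "\<forall>k<N. x $ k = 0"
    by (simp add: sum_nonneg_eq_0_iff)
  with assms(1) show ?thesis by (intro eq_vecI) auto
qed

lemma vinner_add_self:
  assumes "x \<in> carrier_vec N" "y \<in> carrier_vec N"
  shows "vinner (x + y) (x + y) = vinner x x + 2 * vinner x y + vinner y y"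
  using assms
  by (simp add: vinner_def inner_add_left inner_add_right inner_commute sum.distrib
      sum_distrib_left algebra_simps)

lemma vsubspace_diff:
  assumes "vsubspace N S" "x \<in> S" "y \<in> S"
  shows "x - y \<in> S"
proof -
  have "x \<in> carrier_vec N" "y \<in> carrier_vec N"
    using assms by (auto simp: vsubspace_def)
  hence "x - y = x + vscale (-1) y"
    by (intro eq_vecI) (auto simp: vscale_def)
  with assms show ?thesis by (simp add: vsubspace_def)
qed

text \<open>
  With \<open>t = T (u + w)\<close>, Pythagoras gives \<open>\<parallel>u + w - t\<parallel>\<^sup>2 = \<parallel>u - t\<parallel>\<^sup>2 + \<parallel>w\<parallel>\<^sup>2\<close>. By minimality this is at
  most the squared distance \<open>\<parallel>w\<parallel>\<^sup>2\<close> that the competitor \<open>u\<close> attains, which forces \<open>t = u\<close>.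
\<close>

lemma orth_projector_decomposition:
  assumes S: "vsubspace N S" and T: "orth_projector N S T"
    and u: "u \<in> S" and w: "w \<in> vperp N S"
  shows "T (u + w) = u"
proof -
  let ?t = "T (u + w)"
  have uc: "u \<in> carrier_vec N" and wc: "w \<in> carrier_vec N"
    using S u w by (auto simp: vsubspace_def vperp_def)
  hence "is_arg_min (\<lambda>s. vnorm (u + w - s)) (\<lambda>s. s \<in> S) ?t"
    using T by (simp add: orth_projector_def)
  hence t: "?t \<in> S" and min: "vnorm (u + w - ?t) \<le> vnorm (u + w - u)"
    using u by (auto simp: is_arg_min_linorder)
  have tc: "?t \<in> carrier_vec N"
    using S t by (auto simp: vsubspace_def)
  have dist_t: "u + w - ?t = (u - ?t) + w" and dist_u: "u + w - u = w"
    using uc wc tc by (auto intro!: eq_vecI)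
  have "vinner (u - ?t) w = 0"
    using vsubspace_diff[OF S u t] w by (simp add: vperp_def)
  hence "vinner (u + w - ?t) (u + w - ?t) = vinner (u - ?t) (u - ?t) + vinner w w"
    unfolding dist_t using uc wc tc by (subst vinner_add_self[of _ N]) auto
  moreover have "vinner (u + w - ?t) (u + w - ?t) \<le> vinner w w"
    using min unfolding vnorm_def dist_u by simp
  ultimately have "vinner (u - ?t) (u - ?t) \<le> 0" by simp
  hence diff: "u - ?t = 0\<^sub>v N"
    using uc tc by (intro vinner_self_eq_0) auto
  show ?thesis
  proof (rule eq_vecI)
    fix k assume k: "k < dim_vec u"
    have "(u - ?t) $ k = 0"
      using diff k uc by simp
    thus "?t $ k = u $ k"
      using k uc tc by simp
  qed (use uc tc in simp)
qed

text \<open>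
  The full-system operator assembles its blocks by the same formula as the full projector, with
  component maps that are constant once the network state is fixed. This transfers the block
  calculus of the projector to the operator.
\<close>

lemma full_op_eq_full_proj:
  "full_op n nx ny A f x = full_proj n nx (\<lambda>i _. f i (block_sel ny n i \<star> A \<star> x)) y"
  by (simp add: full_op_def full_proj_def)

lemma block_full_op:
  assumes "i < n" "f i \<in> carrier_vec (ny i) \<rightarrow> carrier_vec (nx i)"
  shows "block_sel nx n i \<star> full_op n nx ny A f x = f i (block_sel ny n i \<star> A \<star> x)"
proof -
  have "block_sel ny n i \<star> A \<star> x \<in> carrier_vec (ny i)"
    by (rule carrier_vecI) (rule block_sel_act(1)[OF assms(1)])
  with assms(2) have "f i (block_sel ny n i \<star> A \<star> x) \<in> carrier_vec (nx i)"
    by (rule funcset_mem)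
  with assms(1) show ?thesis
    by (simp add: full_op_eq_full_proj[where y = undefined] block_full_proj)
qed

theorem proposition5p6:
  fixes n :: nat and nx ny :: "nat \<Rightarrow> nat" and A :: "real mat"
    and f fbar P :: "nat \<Rightarrow> 'v::real_inner vec \<Rightarrow> 'v vec"
    and X Xbar :: "nat \<Rightarrow> 'v vec set"
    and x_star xbar_star :: "'v vec"
  assumes "A \<in> carrier_mat (sum ny {..<n}) (sum nx {..<n})"
    and "elements_mat A \<subseteq> {0, 1}"
    and "\<And>i. i < n \<Longrightarrow>
      block_sel ny n i * A * transpose_mat (block_sel nx n i) = 0\<^sub>m (ny i) (nx i)"
    and "\<And>i. i < n \<Longrightarrow> f i \<in> carrier_vec (ny i) \<rightarrow> carrier_vec (nx i)"
    and "\<And>i. i < n \<Longrightarrow> fbar i \<in> carrier_vec (ny i) \<rightarrow> carrier_vec (nx i)"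
    and "\<And>i. i < n \<Longrightarrow> vsubspace (nx i) (X i)"
    and "\<And>i. i < n \<Longrightarrow> vsubspace (nx i) (Xbar i)"
    and "\<And>i. i < n \<Longrightarrow> X i \<subseteq> Xbar i"
    and "\<And>i. i < n \<Longrightarrow> f i ` carrier_vec (ny i) \<subseteq> X i"
    and "\<And>i. i < n \<Longrightarrow> fbar i ` carrier_vec (ny i) \<subseteq> Xbar i"
    and "\<And>i. i < n \<Longrightarrow> orth_projector (nx i) (X i) (P i)"
    and "\<And>i. i < n \<Longrightarrow>
      \<exists>fperp. fperp \<in> carrier_vec (ny i) \<rightarrow> carrier_vec (nx i) \<and>
        fperp ` carrier_vec (ny i) \<subseteq> vperp (nx i) (X i) \<and>
        (\<forall>x\<in>carrier_vec (sum nx {..<n}).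
          fbar i (block_sel ny n i \<star> A \<star> x) =
            f i (block_sel ny n i \<star> A \<star> full_proj n nx P x) + fperp (block_sel ny n i \<star> A \<star> x))"
    and "\<exists>!x. x \<in> carrier_vec (sum nx {..<n}) \<and> x = full_op n nx ny A f x"
    and "x_star \<in> carrier_vec (sum nx {..<n})" and "x_star = full_op n nx ny A f x_star"
    and "xbar_star \<in> carrier_vec (sum nx {..<n})"
    and "xbar_star = full_op n nx ny A fbar xbar_star"
  shows "x_star = full_proj n nx P xbar_star \<and>
    full_proj n nx P xbar_star - x_star = 0\<^sub>v (sum nx {..<n})"
proof -
  let ?Px = "full_proj n nx P xbar_star"
  have blocks: "P i (block_sel nx n i \<star> xbar_star) = f i (block_sel ny n i \<star> A \<star> ?Px)"
    if i: "i < n" for i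
  proof -
    have in_carrier: "block_sel ny n i \<star> y \<in> carrier_vec (ny i)" for y :: "'v vec"
      by (rule carrier_vecI) (rule block_sel_act(1)[OF i])
    obtain fperp where perp: "fperp ` carrier_vec (ny i) \<subseteq> vperp (nx i) (X i)"
      and split: "fbar i (block_sel ny n i \<star> A \<star> xbar_star) =
        f i (block_sel ny n i \<star> A \<star> ?Px) + fperp (block_sel ny n i \<star> A \<star> xbar_star)"
      using assms(12)[OF i] assms(16) by blast
    have "block_sel nx n i \<star> xbar_star = fbar i (block_sel ny n i \<star> A \<star> xbar_star)"
      using block_full_op[of i n fbar ny nx A xbar_star] i assms(5)[OF i] assms(17) by simp
    moreover have "f i (block_sel ny n i \<star> A \<star> ?Px) \<in> X i"
      using assms(9)[OF i] in_carrier by blast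
    moreover have "fperp (block_sel ny n i \<star> A \<star> xbar_star) \<in> vperp (nx i) (X i)"
      using perp in_carrier by blast
    ultimately show ?thesis
      using orth_projector_decomposition[OF assms(6)[OF i] assms(11)[OF i]] split by simp
  qed
  have "?Px = full_op n nx ny A f ?Px"
    unfolding full_op_eq_full_proj[of n nx ny A f ?Px xbar_star]
    by (rule vec_block_eqI[of _ nx n]) (auto simp: full_proj_carrier full_proj_index blocks)
  hence "x_star = ?Px"
    using assms(13-15) full_proj_carrier[of n nx P xbar_star] by blast
  thus ?thesis
    using assms(14) by auto
qed

end
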